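(* Let $x_1,\dots,x_n$ be independent samples of a mean-zero sub-Gaussian distribution on $\mathbb{R}^d$ (with $O(1)$ sub-Gaussian constant) with covariance $\Sigma$, $\|\Sigma\|_{\mathrm{op}}\le1$, and suppose $n\ge d(\log d)^{C_0}$ for a sufficiently large absolute constant $C_0$. Then with probability at least $1-n^{-\omega(1)}$, $\Big\|\sum_{i=1}^n(x_i\otimes x_i)(x_i\otimes x_i)^\top\Big\|_{\mathrm{op}}=O(nd).$
   Context: $x\otimes x\in\mathbb{R}^{d^2}$ is the Kronecker (tensor) product. *)

theory Defs
  imports "HOL-Probability.Probability"
begin

text \<open>Vectors in R^m are represented as functions nat => real, only indices < m matter.
  Matrices in R^{m x m} as functions nat => nat => real.\<close>

definition sq_norm_vec :: "nat \<Rightarrow> (nat \<Rightarrow> real) \<Rightarrow> real" where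
  "sq_norm_vec m v = (\<Sum>j<m. (v j)^2)"

definition inner_vec :: "nat \<Rightarrow> (nat \<Rightarrow> real) \<Rightarrow> (nat \<Rightarrow> real) \<Rightarrow> real" where
  "inner_vec m v x = (\<Sum>j<m. v j * x j)"

definition opnorm :: "nat \<Rightarrow> (nat \<Rightarrow> nat \<Rightarrow> real) \<Rightarrow> real" where
  "opnorm m M = (SUP v \<in> {v. sq_norm_vec m v \<le> 1}.
      sqrt (\<Sum>i<m. (\<Sum>j<m. M i j * v j)^2))"

text \<open>Kronecker product of x, y in R^d, an element of R^{d^2}; index (a,b) is a*d+b.\<close>
definition kron :: "nat \<Rightarrow> (nat \<Rightarrow> real) \<Rightarrow> (nat \<Rightarrow> real) \<Rightarrow> (nat \<Rightarrow> real)" where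
  "kron d x y = (\<lambda>p. x (p div d) * y (p mod d))"

definition outer :: "(nat \<Rightarrow> real) \<Rightarrow> (nat \<Rightarrow> real) \<Rightarrow> (nat \<Rightarrow> nat \<Rightarrow> real)" where
  "outer u w = (\<lambda>i j. u i * w j)"

definition distr_Rd :: "nat \<Rightarrow> (nat \<Rightarrow> real) measure \<Rightarrow> bool" where
  "distr_Rd d \<mu> \<longleftrightarrow> prob_space \<mu> \<and> sets \<mu> = sets (PiM {..<d} (\<lambda>_. (borel :: real measure)))"

text \<open>Sub-Gaussian with constant K (psi_2-norm of every one-dimensional marginal at most K).\<close>
definition subgaussian :: "nat \<Rightarrow> real \<Rightarrow> (nat \<Rightarrow> real) measure \<Rightarrow> bool" where
  "subgaussian d K \<mu> \<longleftrightarrow> (\<forall>v. sq_norm_vec d v = 1 \<longrightarrow>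
      integrable \<mu> (\<lambda>x. exp ((inner_vec d v x)^2 / K^2)) \<and>
      (\<integral>x. exp ((inner_vec d v x)^2 / K^2) \<partial>\<mu>) \<le> 2)"

definition mean_zero :: "nat \<Rightarrow> (nat \<Rightarrow> real) measure \<Rightarrow> bool" where
  "mean_zero d \<mu> \<longleftrightarrow> (\<forall>j<d. integrable \<mu> (\<lambda>x. x j) \<and> (\<integral>x. x j \<partial>\<mu>) = 0)"

definition covariance :: "(nat \<Rightarrow> real) measure \<Rightarrow> nat \<Rightarrow> nat \<Rightarrow> real" where
  "covariance \<mu> j k = (\<integral>x. x j * x k \<partial>\<mu>)"

definition fourth_moment_matrix ::
  "nat \<Rightarrow> nat \<Rightarrow> (nat \<Rightarrow> nat \<Rightarrow> real) \<Rightarrow> (nat \<Rightarrow> nat \<Rightarrow> real)" where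
  "fourth_moment_matrix d n X = (\<lambda>p q. \<Sum>i<n. outer (kron d (X i) (X i)) (kron d (X i) (X i)) p q)"

end

theory Submission
  imports Defs "HOL-Real_Asymp.Real_Asymp"
begin

text \<open>The operator norm of \<open>\<Sum>\<^sub>i k\<^sub>i k\<^sub>i\<^sup>T\<close> with \<open>k\<^sub>i = x\<^sub>i \<otimes> x\<^sub>i\<close> is at most the largest absolute row sum of the
  Gram matrix \<open>\<langle>k\<^sub>i, k\<^sub>j\<rangle> = \<langle>x\<^sub>i, x\<^sub>j\<rangle>\<^sup>2\<close> over the samples with \<open>\<bar>x\<^sub>i\<bar>\<^sup>2 < 8 K\<^sup>2 d\<close> (Schur test), plus
  \<open>\<Sum> \<bar>x\<^sub>i\<bar>\<^sup>4\<close> over the remaining outliers. Conditionally on \<open>x\<^sub>i\<close>, the off-diagonal row sum is a sum of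
  independent squares of one-dimensional marginals, so it is \<open>O(n \<bar>x\<^sub>i\<bar>\<^sup>2)\<close> up to probability \<open>e\<^sup>-\<^sup>n\<close>; the
  diagonal entry is \<open>O(d\<^sup>2)\<close>, which is \<open>O(nd)\<close> since \<open>d \<le> n\<close>. Outliers are so rare that
  \<open>\<bar>x\<bar>\<^sup>4\<close> restricted to them has bounded mean with uniform stretched-exponential tails, hence their
  contribution is \<open>O(n)\<close> by truncating \<open>\<bar>x\<bar>\<^sup>4\<close> at order \<open>n\<^sup>1\<^sup>/\<^sup>2\<close> and a Chernoff bound.\<close>

section \<open>Kronecker products and Gram entries\<close>

text \<open>The index range splits into \<open>d\<close> blocks of length \<open>e\<close>; on block
  \<open>a\<close> the quotient is constantly \<open>a\<close> and the remainder runs through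
  \<open>{..<e}\<close>.\<close>

lemma sum_mult_div_mod:
  fixes f g :: "nat \<Rightarrow> real"
  shows "(\<Sum>p<d*e. f (p div e) * g (p mod e)) = (\<Sum>a<d. f a) * (\<Sum>b<e. g b)"
proof (cases "e = 0")
  case False
  have "(\<Sum>p<d*e. f (p div e) * g (p mod e)) =
      (\<Sum>a<d. \<Sum>p = a*e..<a*e+e. f (p div e) * g (p mod e))"
    by (rule sum.nat_group[symmetric])
  also have "\<dots> = (\<Sum>a<d. \<Sum>b<e. f a * g b)"
  proof (rule sum.cong[OF refl])
    fix a
    have "(\<Sum>p = a*e..<a*e+e. f (p div e) * g (p mod e)) =
        (\<Sum>b = 0..<e. f ((b + a*e) div e) * g ((b + a*e) mod e))"
      using sum.shift_bounds_nat_ivl[of "\<lambda>p. f (p div e) * g (p mod e)" 0 "a*e" e]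
      by (simp add: add.commute)
    also have "\<dots> = (\<Sum>b<e. f a * g b)"
      using False by (intro sum.cong) auto
    finally show "(\<Sum>p = a*e..<a*e+e. f (p div e) * g (p mod e)) = (\<Sum>b<e. f a * g b)" .
  qed
  finally show ?thesis by (simp add: sum_product)
qed simp

text \<open>Multiplicativity of the inner product on pure tensors; in particular all Gram entries of
  the tensors are nonnegative.\<close>

lemma inner_vec_kron: "inner_vec (d*d) (kron d x x) (kron d y y) = (inner_vec d x y)\<^sup>2"
  using sum_mult_div_mod[of "\<lambda>a. x a * y a" d "\<lambda>a. x a * y a" d]
  by (simp add: inner_vec_def kron_def power2_eq_square mult_ac)

lemma sq_norm_vec_eq_inner: "sq_norm_vec d x = inner_vec d x x"
  by (simp add: sq_norm_vec_def inner_vec_def power2_eq_square)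

lemma sq_norm_vec_nonneg: "0 \<le> sq_norm_vec d x"
  by (simp add: sq_norm_vec_def sum_nonneg)

lemma sq_norm_vec_scale: "sq_norm_vec d (\<lambda>j. c * x j) = c\<^sup>2 * sq_norm_vec d x"
  by (simp add: sq_norm_vec_def power_mult_distrib sum_distrib_left)

lemma inner_vec_commute: "inner_vec d x y = inner_vec d y x"
  by (simp add: inner_vec_def mult.commute)

lemma inner_vec_sum_right: "inner_vec d y (\<lambda>p. \<Sum>i\<in>I. b i * k i p) = (\<Sum>i\<in>I. b i * inner_vec d y (k i))"
  unfolding inner_vec_def sum_distrib_left
  by (subst sum.swap) (simp add: mult_ac)

lemma inner_vec_Cauchy_Schwarz: "(inner_vec d x y)\<^sup>2 \<le> sq_norm_vec d x * sq_norm_vec d y"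
  by (simp add: inner_vec_def sq_norm_vec_def Cauchy_Schwarz_ineq_sum)

section \<open>The operator norm as a family of quadratic inequalities\<close>

text \<open>By homogeneity, a vector of nonzero norm rescales to a unit vector, so the supremum can
  be traded for an inequality over all vectors.\<close>

lemma opnorm_le_iff:
  assumes "0 \<le> c"
  shows "opnorm m M \<le> c \<longleftrightarrow>
    (\<forall>v. (\<Sum>i<m. (\<Sum>j<m. M i j * v j)\<^sup>2) \<le> c\<^sup>2 * sq_norm_vec m v)" (is "_ \<longleftrightarrow> (\<forall>v. ?Q v \<le> _)")
proof
  assume *: "\<forall>v. ?Q v \<le> c\<^sup>2 * sq_norm_vec m v"
  show "opnorm m M \<le> c" unfolding opnorm_def
  proof (rule cSUP_least)
    show "{v. sq_norm_vec m v \<le> 1} \<noteq> {}"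
      by (auto simp: sq_norm_vec_def intro: exI[of _ "\<lambda>_. 0"])
    fix v assume "v \<in> {v. sq_norm_vec m v \<le> 1}"
    then have "c\<^sup>2 * sq_norm_vec m v \<le> c\<^sup>2 * 1"
      by (intro mult_left_mono) auto
    moreover have "?Q v \<le> c\<^sup>2 * sq_norm_vec m v" using * by blast
    ultimately have "?Q v \<le> c\<^sup>2" by simp
    then show "sqrt (?Q v) \<le> c" using assms by (simp add: real_le_lsqrt)
  qed
next
  assume *: "opnorm m M \<le> c"
  \<comment> \<open>A real supremum dominates its members only if the set is bounded above. On the
    unit ball all coordinates are at most 1 in absolute value, so the absolute row sums of
    \<open>M\<close> give a bound.\<close>
  have bdd: "bdd_above ((\<lambda>v. sqrt (?Q v)) ` {v. sq_norm_vec m v \<le> 1})"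
  proof (rule bdd_aboveI2)
    fix v assume v: "v \<in> {v. sq_norm_vec m v \<le> 1}"
    have 1: "\<bar>v j\<bar> \<le> 1" if "j < m" for j
    proof -
      have "(v j)\<^sup>2 \<le> sq_norm_vec m v" unfolding sq_norm_vec_def
        using that by (intro member_le_sum) auto
      then have "(v j)\<^sup>2 \<le> 1" using v by simp
      then show ?thesis by (simp add: abs_square_le_1)
    qed
    have "?Q v \<le> (\<Sum>i<m. (\<Sum>j<m. \<bar>M i j\<bar>)\<^sup>2)"
    proof (rule sum_mono)
      fix i
      have "\<bar>\<Sum>j<m. M i j * v j\<bar> \<le> (\<Sum>j<m. \<bar>M i j\<bar>)"
        using 1 by (intro order.trans[OF sum_abs] sum_mono)
          (auto simp: abs_mult intro: mult_left_le)
      then show "(\<Sum>j<m. M i j * v j)\<^sup>2 \<le> (\<Sum>j<m. \<bar>M i j\<bar>)\<^sup>2"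
        by (metis abs_ge_zero power2_abs power_mono)
    qed
    then show "sqrt (?Q v) \<le> sqrt (\<Sum>i<m. (\<Sum>j<m. \<bar>M i j\<bar>)\<^sup>2)" by simp
  qed
  have unit: "?Q v \<le> c\<^sup>2" if "sq_norm_vec m v \<le> 1" for v
  proof -
    have "sqrt (?Q v) \<le> opnorm m M" unfolding opnorm_def
      using that by (intro cSUP_upper[OF _ bdd]) auto
    with * have "sqrt (?Q v) \<le> c" by simp
    then show ?thesis by (simp add: sqrt_le_D)
  qed
  show "\<forall>v. ?Q v \<le> c\<^sup>2 * sq_norm_vec m v"
  proof
    fix v
    show "?Q v \<le> c\<^sup>2 * sq_norm_vec m v"
    proof (cases "sq_norm_vec m v = 0")
      case True
      then have "v j = 0" if "j < m" for j
        using that by (auto simp: sq_norm_vec_def sum_nonneg_eq_0_iff)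
      then show ?thesis using assms True by simp
    next
      case False
      define s where "s = 1 / sqrt (sq_norm_vec m v)"
      have s: "s\<^sup>2 * sq_norm_vec m v = 1" "s\<^sup>2 > 0"
        using False sq_norm_vec_nonneg[of m v] by (auto simp: s_def power_divide)
      have "?Q (\<lambda>j. s * v j) \<le> c\<^sup>2"
        by (rule unit) (simp add: sq_norm_vec_scale s)
      also have "?Q (\<lambda>j. s * v j) = s\<^sup>2 * ?Q v"
        by (simp add: sum_distrib_left power_mult_distrib[symmetric] mult_ac)
      also have "c\<^sup>2 = s\<^sup>2 * (c\<^sup>2 * sq_norm_vec m v)" using s by (simp add: algebra_simps)
      finally show ?thesis using s(2) by simp
    qed
  qed
qed

text \<open>Both sides are continuous in the vector, so rational vectors suffice. Coding them as
  lists puts the quantifier over a countable type, as measurability requires.\<close>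

lemma opnorm_le_iff_rat:
  assumes "0 \<le> c"
  shows "opnorm m M \<le> c \<longleftrightarrow>
    (\<forall>w::rat list. (\<Sum>i<m. (\<Sum>j<m. M i j * of_rat (w ! j))\<^sup>2) \<le> c\<^sup>2 * sq_norm_vec m (\<lambda>j. of_rat (w ! j)))"
  unfolding opnorm_le_iff[OF assms]
proof safe
  fix v :: "nat \<Rightarrow> real"
  assume *: "\<forall>w::rat list. (\<Sum>i<m. (\<Sum>j<m. M i j * of_rat (w ! j))\<^sup>2) \<le> c\<^sup>2 * sq_norm_vec m (\<lambda>j. of_rat (w ! j))"
  have "\<exists>q::rat. v j < of_rat q \<and> of_rat q < v j + 1 / Suc k" for j k
    using of_rat_dense[of "v j" "v j + 1 / Suc k"] by auto
  then obtain q :: "nat \<Rightarrow> nat \<Rightarrow> rat"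
    where q: "\<And>j k. v j < of_rat (q j k)" "\<And>j k. of_rat (q j k) < v j + 1 / Suc k"
    by metis
  have lim: "(\<lambda>k. real_of_rat (q j k)) \<longlonglongrightarrow> v j" for j
  proof (rule tendsto_sandwich[of "\<lambda>_. v j" _ _ "\<lambda>k. v j + 1 / Suc k"])
    have "(\<lambda>k. v j + 1 / Suc k) \<longlonglongrightarrow> v j + 0"
      by (intro tendsto_intros LIMSEQ_Suc lim_1_over_n)
    then show "(\<lambda>k. v j + 1 / Suc k) \<longlonglongrightarrow> v j" by simp
  qed (use q in \<open>auto intro!: always_eventually less_imp_le simp del: of_nat_Suc\<close>)
  have le: "(\<Sum>i<m. (\<Sum>j<m. M i j * of_rat (q j k))\<^sup>2) \<le> c\<^sup>2 * sq_norm_vec m (\<lambda>j. of_rat (q j k))" for k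
    using *[rule_format, of "map (\<lambda>j. q j k) [0..<m]"] by (simp add: sq_norm_vec_def)
  show "(\<Sum>i<m. (\<Sum>j<m. M i j * v j)\<^sup>2) \<le> c\<^sup>2 * sq_norm_vec m v"
  proof (rule LIMSEQ_le)
    show "(\<lambda>k. \<Sum>i<m. (\<Sum>j<m. M i j * of_rat (q j k))\<^sup>2) \<longlonglongrightarrow> (\<Sum>i<m. (\<Sum>j<m. M i j * v j)\<^sup>2)"
      by (intro tendsto_intros lim)
    show "(\<lambda>k. c\<^sup>2 * sq_norm_vec m (\<lambda>j. of_rat (q j k))) \<longlonglongrightarrow> c\<^sup>2 * sq_norm_vec m v"
      unfolding sq_norm_vec_def by (intro tendsto_intros lim)
  qed (use le in auto)
qed auto

section \<open>Schur test and the deterministic bound\<close>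

text \<open>Duality: the left side \<open>S\<close> equals the inner product of \<open>v\<close>
  with \<open>z\<close>, the combination of the \<open>k i\<close> with coefficients
  \<open>b i\<close>. The squared norm of \<open>z\<close> is the Gram form at \<open>b\<close>,
  hence at most \<open>R * S\<close>; Cauchy-Schwarz then allows cancelling one factor
  \<open>S\<close>.\<close>

lemma sum_sq_inner_le_gram_row_sum:
  assumes fin: "finite I" and R: "0 \<le> R"
    and row: "\<And>i. i \<in> I \<Longrightarrow> (\<Sum>j\<in>I. \<bar>inner_vec m (k i) (k j)\<bar>) \<le> R"
  shows "(\<Sum>i\<in>I. (inner_vec m (k i) v)\<^sup>2) \<le> R * sq_norm_vec m v"
proof -
  define b where "b i = inner_vec m (k i) v" for i
  define z where "z = (\<lambda>p. \<Sum>i\<in>I. b i * k i p)"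
  define S where "S = (\<Sum>i\<in>I. (b i)\<^sup>2)"
  let ?G = "\<lambda>i j. inner_vec m (k i) (k j)"
  have S0: "0 \<le> S" by (simp add: S_def sum_nonneg)
  have "S = inner_vec m v z"
    unfolding z_def inner_vec_sum_right S_def b_def by (simp add: power2_eq_square inner_vec_commute)
  then have CS: "S\<^sup>2 \<le> sq_norm_vec m v * sq_norm_vec m z"
    by (simp add: inner_vec_Cauchy_Schwarz)
  have "inner_vec m z (k j) = (\<Sum>i\<in>I. b i * ?G i j)" for j
    by (subst inner_vec_commute) (simp add: z_def inner_vec_sum_right inner_vec_commute[of m "k j"])
  then have "sq_norm_vec m z = (\<Sum>j\<in>I. \<Sum>i\<in>I. b j * b i * ?G i j)"
    by (subst sq_norm_vec_eq_inner, subst (2) z_def)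
       (simp add: inner_vec_sum_right sum_distrib_left mult_ac)
  \<comment> \<open>The bound 2ab \<le> a^2 + b^2 splits each term in two, and symmetry of the Gram
    matrix turns both halves into weighted row sums.\<close>
  also have "\<dots> \<le> (\<Sum>j\<in>I. \<Sum>i\<in>I. ((b j)\<^sup>2 / 2 * \<bar>?G j i\<bar> + (b i)\<^sup>2 / 2 * \<bar>?G i j\<bar>))"
  proof (intro sum_mono)
    fix i j
    have "b j * b i * ?G i j \<le> \<bar>b j * b i\<bar> * \<bar>?G i j\<bar>" by (metis abs_ge_self abs_mult)
    also have "\<dots> \<le> ((b j)\<^sup>2 / 2 + (b i)\<^sup>2 / 2) * \<bar>?G i j\<bar>"
      using sum_squares_bound[of "\<bar>b j\<bar>" "\<bar>b i\<bar>"]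
      by (intro mult_right_mono) (auto simp: abs_mult)
    finally show "b j * b i * ?G i j \<le> (b j)\<^sup>2 / 2 * \<bar>?G j i\<bar> + (b i)\<^sup>2 / 2 * \<bar>?G i j\<bar>"
      by (simp add: inner_vec_commute algebra_simps)
  qed
  also have "\<dots> = (\<Sum>j\<in>I. \<Sum>i\<in>I. (b j)\<^sup>2 / 2 * \<bar>?G j i\<bar>) + (\<Sum>i\<in>I. \<Sum>j\<in>I. (b i)\<^sup>2 / 2 * \<bar>?G i j\<bar>)"
    by (subst (3) sum.swap) (simp add: sum.distrib)
  also have "\<dots> = (\<Sum>i\<in>I. (b i)\<^sup>2 * (\<Sum>j\<in>I. \<bar>?G i j\<bar>))"
    by (simp add: sum_distrib_left sum.distrib[symmetric])
  also have "\<dots> \<le> (\<Sum>i\<in>I. (b i)\<^sup>2 * R)"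
    by (intro sum_mono mult_left_mono row) auto
  finally have "sq_norm_vec m z \<le> R * S"
    by (simp add: S_def sum_distrib_left mult.commute)
  then have "S * S \<le> sq_norm_vec m v * (R * S)"
    using CS mult_left_mono[OF _ sq_norm_vec_nonneg] unfolding power2_eq_square
    by (meson order.trans)
  then have "S \<le> R * sq_norm_vec m v"
    using S0 R sq_norm_vec_nonneg[of m v]
    by (cases "S = 0") (auto simp: mult_ac)
  then show ?thesis by (simp add: S_def b_def)
qed

text \<open>With \<open>z\<close> the image of \<open>v\<close>, the squared norm of
  \<open>z\<close> is the bilinear form at \<open>v\<close> and \<open>z\<close>. Cauchy-Schwarz
  bounds it by the quadratic forms at \<open>v\<close> and at \<open>z\<close>, and a factor
  \<open>sq_norm_vec m z\<close> cancels.\<close>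

lemma opnorm_sum_outer_le:
  fixes n :: nat and k :: "nat \<Rightarrow> nat \<Rightarrow> real"
  assumes L: "0 \<le> L" and quad: "\<And>v. (\<Sum>i<n. (inner_vec m (k i) v)\<^sup>2) \<le> L * sq_norm_vec m v"
  shows "opnorm m (\<lambda>p q. \<Sum>i<n. outer (k i) (k i) p q) \<le> L"
  unfolding opnorm_le_iff[OF L]
proof
  fix v
  define z where "z = (\<lambda>p. \<Sum>i<n. inner_vec m (k i) v * k i p)"
  let ?S = "\<lambda>v. (\<Sum>i<n. (inner_vec m (k i) v)\<^sup>2)"
  have z: "(\<Sum>q<m. (\<Sum>i<n. outer (k i) (k i) p q) * v q) = z p" for p
    unfolding z_def inner_vec_def outer_def sum_distrib_right
    by (subst sum.swap) (simp add: mult_ac)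
  have "sq_norm_vec m z = (\<Sum>i<n. inner_vec m (k i) v * inner_vec m (k i) z)"
    by (subst sq_norm_vec_eq_inner, subst (2) z_def)
       (simp add: inner_vec_sum_right inner_vec_commute[of m z])
  then have "(sq_norm_vec m z)\<^sup>2 \<le> ?S v * ?S z"
    by (simp add: Cauchy_Schwarz_ineq_sum)
  also have "\<dots> \<le> (L * sq_norm_vec m v) * (L * sq_norm_vec m z)"
    by (intro mult_mono quad sum_nonneg mult_nonneg_nonneg L sq_norm_vec_nonneg) auto
  finally have "sq_norm_vec m z \<le> L\<^sup>2 * sq_norm_vec m v"
    using sq_norm_vec_nonneg[of m z] sq_norm_vec_nonneg[of m v] L
    by (cases "sq_norm_vec m z = 0") (auto simp: power2_eq_square mult_ac)
  then show "(\<Sum>p<m. (\<Sum>q<m. (\<Sum>i<n. outer (k i) (k i) p q) * v q)\<^sup>2) \<le> L\<^sup>2 * sq_norm_vec m v"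
    by (simp add: z) (simp add: sq_norm_vec_def)
qed

text \<open>The Schur test handles the indices in \<open>I\<close>; the other rank-one terms are
  bounded by their traces.\<close>

lemma opnorm_sum_outer_le_split:
  fixes n :: nat and k :: "nat \<Rightarrow> nat \<Rightarrow> real"
  assumes R: "0 \<le> R" and I: "I \<subseteq> {..<n}"
    and row: "\<And>i. i \<in> I \<Longrightarrow> (\<Sum>j\<in>I. \<bar>inner_vec m (k i) (k j)\<bar>) \<le> R"
    and rest: "(\<Sum>i\<in>{..<n} - I. sq_norm_vec m (k i)) \<le> B"
  shows "opnorm m (\<lambda>p q. \<Sum>i<n. outer (k i) (k i) p q) \<le> R + B"
proof (rule opnorm_sum_outer_le)
  have "0 \<le> B" using rest by (meson order.trans sum_nonneg sq_norm_vec_nonneg)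
  with R show "0 \<le> R + B" by simp
  fix v
  have "(\<Sum>i<n. (inner_vec m (k i) v)\<^sup>2) =
      (\<Sum>i\<in>I. (inner_vec m (k i) v)\<^sup>2) + (\<Sum>i\<in>{..<n} - I. (inner_vec m (k i) v)\<^sup>2)"
    by (subst add.commute) (intro sum.subset_diff[OF I] finite_lessThan)
  also have "(\<Sum>i\<in>I. (inner_vec m (k i) v)\<^sup>2) \<le> R * sq_norm_vec m v"
    using I R row by (intro sum_sq_inner_le_gram_row_sum) (auto intro: finite_subset)
  also have "(\<Sum>i\<in>{..<n} - I. (inner_vec m (k i) v)\<^sup>2) \<le> (\<Sum>i\<in>{..<n} - I. sq_norm_vec m (k i)) * sq_norm_vec m v"
    unfolding sum_distrib_right by (intro sum_mono inner_vec_Cauchy_Schwarz)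
  also have "\<dots> \<le> B * sq_norm_vec m v"
    by (intro mult_right_mono rest sq_norm_vec_nonneg)
  finally show "(\<Sum>i<n. (inner_vec m (k i) v)\<^sup>2) \<le> (R + B) * sq_norm_vec m v"
    by (simp add: algebra_simps)
qed

text \<open>A row over the small samples costs 64 from the diagonal entry and 2 * 8 = 16 from the
  rest; with 68 from the outliers this gives 148.\<close>

lemma opnorm_fourth_moment_matrix_le:
  fixes d n :: nat and K :: real
  assumes row: "\<And>i. i < n \<Longrightarrow>
      (\<Sum>j\<in>{..<n} - {i}. (inner_vec d (X i) (X j))\<^sup>2) \<le> 2 * K\<^sup>2 * n * sq_norm_vec d (X i)"
    and outliers: "(\<Sum>i | i < n \<and> 8 * K\<^sup>2 * d \<le> sq_norm_vec d (X i). (sq_norm_vec d (X i))\<^sup>2)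
      \<le> 68 * K^4 * n"
    and "1 \<le> d" "d \<le> n"
  shows "opnorm (d*d) (fourth_moment_matrix d n X) \<le> 148 * K^4 * n * d"
proof -
  define I where "I = {i. i < n \<and> sq_norm_vec d (X i) < 8 * K\<^sup>2 * d}"
  have gram: "\<bar>inner_vec (d*d) (kron d x x) (kron d y y)\<bar> = (inner_vec d x y)\<^sup>2" for x y
    by (simp add: inner_vec_kron)
  have sq: "sq_norm_vec (d*d) (kron d x x) = (sq_norm_vec d x)\<^sup>2" for x
    by (simp add: sq_norm_vec_eq_inner inner_vec_kron)
  have "opnorm (d*d) (fourth_moment_matrix d n X) \<le> 80 * K^4 * n * d + 68 * K^4 * n"
    unfolding fourth_moment_matrix_def
  proof (rule opnorm_sum_outer_le_split[where I = I])
    fix i assume i: "i \<in> I"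
    have fin: "finite I" by (simp add: I_def)
    have small: "sq_norm_vec d (X i) \<le> 8 * K\<^sup>2 * d" using i by (simp add: I_def)
    have "(\<Sum>j\<in>I. (inner_vec d (X i) (X j))\<^sup>2) =
        (inner_vec d (X i) (X i))\<^sup>2 + (\<Sum>j\<in>I - {i}. (inner_vec d (X i) (X j))\<^sup>2)"
      by (rule sum.remove[OF fin i])
    also have "(inner_vec d (X i) (X i))\<^sup>2 \<le> (8 * K\<^sup>2 * d)\<^sup>2"
      using small sq_norm_vec_nonneg[of d "X i"]
      by (simp add: sq_norm_vec_eq_inner power_mono)
    also have "(8 * K\<^sup>2 * d)\<^sup>2 = 64 * K^4 * d * d"
      by (simp add: power2_eq_square power4_eq_xxxx)
    also have "\<dots> \<le> 64 * K^4 * d * n"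
      using \<open>d \<le> n\<close> by (intro mult_left_mono) auto
    also have "(\<Sum>j\<in>I - {i}. (inner_vec d (X i) (X j))\<^sup>2) \<le> (\<Sum>j\<in>{..<n} - {i}. (inner_vec d (X i) (X j))\<^sup>2)"
      by (intro sum_mono2) (auto simp: I_def)
    also have "\<dots> \<le> 2 * K\<^sup>2 * n * sq_norm_vec d (X i)"
      using i by (intro row) (simp add: I_def)
    also have "\<dots> \<le> 2 * K\<^sup>2 * n * (8 * K\<^sup>2 * d)"
      by (intro mult_left_mono small) auto
    finally show "(\<Sum>j\<in>I. \<bar>inner_vec (d*d) (kron d (X i) (X i)) (kron d (X j) (X j))\<bar>) \<le> 80 * K^4 * n * d"
      unfolding gram by (simp add: power2_eq_square power4_eq_xxxx algebra_simps)
  next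
    have "{..<n} - I = {i. i < n \<and> 8 * K\<^sup>2 * d \<le> sq_norm_vec d (X i)}"
      by (auto simp: I_def)
    then show "(\<Sum>i\<in>{..<n} - I. sq_norm_vec (d*d) (kron d (X i) (X i))) \<le> 68 * K^4 * n"
      using outliers by (simp add: sq)
  qed (auto simp: I_def)
  moreover have "68 * K^4 * real n * 1 \<le> 68 * K^4 * n * d"
    using \<open>1 \<le> d\<close> by (intro mult_left_mono) auto
  ultimately show ?thesis by simp
qed

section \<open>Measurability and Markov's inequality\<close>

lemma inner_vec_measurable [measurable (raw)]:
  assumes "f \<in> measurable N (PiM {..<d} (\<lambda>_. borel))" "g \<in> measurable N (PiM {..<d} (\<lambda>_. borel))"
  shows "(\<lambda>\<omega>. inner_vec d (f \<omega>) (g \<omega>)) \<in> borel_measurable N"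
  unfolding inner_vec_def
  by (intro borel_measurable_sum borel_measurable_times
      measurable_compose[OF assms(1) measurable_component_singleton]
      measurable_compose[OF assms(2) measurable_component_singleton]) auto

lemma sq_norm_vec_measurable [measurable (raw)]:
  assumes "f \<in> measurable N (PiM {..<d} (\<lambda>_. borel))"
  shows "(\<lambda>\<omega>. sq_norm_vec d (f \<omega>)) \<in> borel_measurable N"
  unfolding sq_norm_vec_eq_inner by (intro inner_vec_measurable assms)

text \<open>Stated separately because a fixed \<open>v\<close> need not be extensional, so it may
  lie outside the space of the product measure.\<close>

lemma inner_vec_const_measurable [measurable (raw)]:
  assumes "f \<in> measurable N (PiM {..<d} (\<lambda>_. borel))"
  shows "(\<lambda>\<omega>. inner_vec d v (f \<omega>)) \<in> borel_measurable N"
  unfolding inner_vec_def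
  by (intro borel_measurable_sum borel_measurable_times borel_measurable_const
      measurable_compose[OF assms(1) measurable_component_singleton]) auto

text \<open>Markov's inequality at threshold 1; \<open>g\<close> will be an exponential already
  divided by its value at the threshold.\<close>

lemma emeasure_Collect_le_nn_integral:
  assumes "{x \<in> space M. Q x} \<in> sets M"
    and "\<And>x. x \<in> space M \<Longrightarrow> Q x \<Longrightarrow> 1 \<le> g x"
  shows "emeasure M {x \<in> space M. Q x} \<le> (\<integral>\<^sup>+x. g x \<partial>M)"
proof -
  have "emeasure M {x \<in> space M. Q x} = (\<integral>\<^sup>+x. indicator {x \<in> space M. Q x} x \<partial>M)"
    using assms(1) by simp
  also have "\<dots> \<le> (\<integral>\<^sup>+x. g x \<partial>M)"
    using assms(2) by (intro nn_integral_mono) (auto simp: indicator_def)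
  finally show ?thesis .
qed

section \<open>One-dimensional Gaussian integrals\<close>

lemma nn_integral_normal_density [simp]:
  "0 < \<sigma> \<Longrightarrow> (\<integral>\<^sup>+g. ennreal (normal_density m \<sigma> g) \<partial>lborel) = 1"
  by (subst nn_integral_eq_integral) auto

text \<open>Completing the square shifts the Gaussian to mean \<open>y\<close>.\<close>

lemma nn_integral_std_normal_exp:
  "(\<integral>\<^sup>+g. ennreal (exp (y * g) * std_normal_density g) \<partial>lborel) = ennreal (exp (y\<^sup>2 / 2))"
proof -
  have "exp (y * g) * std_normal_density g = exp (y\<^sup>2 / 2) * normal_density y 1 g" for g
    by (simp add: normal_density_def exp_add[symmetric] power2_eq_square field_simps)
  then show ?thesis
    by (simp add: ennreal_mult nn_integral_cmult)
qed

text \<open>The weight turns the standard Gaussian into \<open>sqrt 2\<close> times the centred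
  Gaussian density of variance 2.\<close>

lemma nn_integral_std_normal_exp_square:
  "(\<integral>\<^sup>+g. ennreal (exp (g\<^sup>2 / 4) * std_normal_density g) \<partial>lborel) = ennreal (sqrt 2)"
proof -
  have "exp (g\<^sup>2 / 4) * std_normal_density g = sqrt 2 * normal_density 0 (sqrt 2) g" for g
  proof -
    have "exp (g\<^sup>2 / 4) * exp (- g\<^sup>2 / 2) = exp (- g\<^sup>2 / 4)"
      by (simp add: exp_add[symmetric])
    then show ?thesis
      by (simp add: normal_density_def real_sqrt_mult field_simps)
  qed
  then show ?thesis
    by (simp add: ennreal_mult nn_integral_cmult)
qed

section \<open>A Chernoff bound for bounded nonnegative summands\<close>

text \<open>The Chernoff parameter is 1/\<open>B\<close>: for u = f/B in [0,1], exp u \<le> 1 + 2u,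
  so each exponential moment is at most exp (2a/B). The extra 1 in the threshold leaves exp
  (-n/B).\<close>

lemma (in prob_space) emeasure_PiM_sum_gt_le:
  fixes f :: "'a \<Rightarrow> real" and n :: nat and a B :: real
  assumes [measurable]: "f \<in> borel_measurable M"
    and f: "\<And>x. x \<in> space M \<Longrightarrow> 0 \<le> f x" "\<And>x. x \<in> space M \<Longrightarrow> f x \<le> B"
    and B: "0 < B" and a: "0 \<le> a" "(\<integral>\<^sup>+x. ennreal (f x) \<partial>M) \<le> ennreal a"
  shows "emeasure (PiM {..<n} (\<lambda>_. M)) {X \<in> space (PiM {..<n} (\<lambda>_. M)). (2*a+1) * n < (\<Sum>i<n. f (X i))}
    \<le> ennreal (exp (- (n / B)))"
proof -
  interpret P: product_sigma_finite "\<lambda>_::nat. M"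
    by (simp add: product_sigma_finite_def sigma_finite_measure_axioms)
  let ?P = "PiM {..<n} (\<lambda>_. M)"
  have exp_f: "(\<integral>\<^sup>+x. ennreal (exp (f x / B)) \<partial>M) \<le> ennreal (exp (2 * a / B))"
  proof -
    have "(\<integral>\<^sup>+x. ennreal (exp (f x / B)) \<partial>M) \<le> (\<integral>\<^sup>+x. 1 + ennreal (2/B) * ennreal (f x) \<partial>M)"
    proof (rule nn_integral_mono)
      fix x assume x: "x \<in> space M"
      have u: "0 \<le> f x / B" "f x / B \<le> 1" using f[OF x] B by auto
      have "exp (f x / B) \<le> 1 + f x / B + (f x / B)\<^sup>2" by (rule exp_bound[OF u])
      also have "(f x / B)\<^sup>2 \<le> f x / B"
        unfolding power2_eq_square using u by (rule mult_left_le[rotated])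
      finally have "exp (f x / B) \<le> 1 + 2/B * f x" by simp
      then show "ennreal (exp (f x / B)) \<le> 1 + ennreal (2/B) * ennreal (f x)"
        using f[OF x] B
        by (metis ennreal_leI ennreal_1 ennreal_mult ennreal_plus less_imp_le mult_nonneg_nonneg
            zero_le_divide_iff zero_le_numeral zero_le_one)
    qed
    also have "\<dots> = 1 + ennreal (2/B) * (\<integral>\<^sup>+x. ennreal (f x) \<partial>M)"
      by (simp add: nn_integral_add nn_integral_cmult emeasure_space_1)
    also have "\<dots> \<le> 1 + ennreal (2/B) * ennreal a"
      by (intro add_left_mono mult_left_mono a) auto
    also have "\<dots> = ennreal (1 + 2 * a / B)"
      using a B by (simp add: ennreal_mult[symmetric] ennreal_plus[symmetric] ennreal_1[symmetric]
          del: ennreal_1 ennreal_plus)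
    also have "\<dots> \<le> ennreal (exp (2 * a / B))"
      by (intro ennreal_leI exp_ge_add_one_self)
    finally show ?thesis .
  qed
  have "emeasure ?P {X \<in> space ?P. (2*a+1) * n < (\<Sum>i<n. f (X i))}
      \<le> (\<integral>\<^sup>+X. ennreal (exp (- ((2*a+1) * n / B))) * (\<Prod>i<n. ennreal (exp (f (X i) / B))) \<partial>?P)"
  proof (rule emeasure_Collect_le_nn_integral)
    fix X assume *: "(2*a+1) * n < (\<Sum>i<n. f (X i))"
    have "0 \<le> - ((2*a+1) * n / B) + (\<Sum>i<n. f (X i) / B)"
      using * B by (simp add: sum_divide_distrib[symmetric] field_simps)
    then have "1 \<le> exp (- ((2*a+1) * n / B)) * (\<Prod>i<n. exp (f (X i) / B))"
      unfolding exp_sum[OF finite_lessThan, symmetric] exp_add[symmetric] by simp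
    then show "1 \<le> ennreal (exp (- ((2*a+1) * n / B))) * (\<Prod>i<n. ennreal (exp (f (X i) / B)))"
      by (simp add: prod_ennreal ennreal_mult'[symmetric] prod_nonneg)
  qed measurable
  also have "\<dots> = ennreal (exp (- ((2*a+1) * n / B))) * (\<integral>\<^sup>+x. ennreal (exp (f x / B)) \<partial>M) ^ n"
    by (simp add: nn_integral_cmult P.product_nn_integral_prod[of "{..<n}" "\<lambda>_ x. ennreal (exp (f x / B))"])
  also have "\<dots> \<le> ennreal (exp (- ((2*a+1) * n / B))) * ennreal (exp (2 * a / B)) ^ n"
    by (intro mult_left_mono power_mono exp_f) auto
  also have "\<dots> = ennreal (exp (- ((2*a+1) * n / B)) * exp (2 * a / B) ^ n)"
    by (simp add: ennreal_mult ennreal_power)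
  also have "exp (- ((2*a+1) * n / B)) * exp (2 * a / B) ^ n = exp (- (n / B))"
    by (simp add: exp_of_nat_mult[symmetric] exp_add[symmetric] add_divide_distrib algebra_simps)
  finally show ?thesis .
qed

section \<open>Exponential moments of a sub-Gaussian vector\<close>

locale subgaussian_distr = prob_space \<mu> for \<mu> :: "(nat \<Rightarrow> real) measure" +
  fixes d :: nat and K :: real
  assumes sets_eq [measurable_cong]: "sets \<mu> = sets (PiM {..<d} (\<lambda>_. borel))"
    and subgaussian: "subgaussian d K \<mu>" and K_pos: "0 < K" and d_ge_1: "1 \<le> d"
begin

text \<open>The sub-Gaussian hypothesis for the normalised direction, rewritten in homogeneous
  form.\<close>

lemma nn_integral_exp_inner:
  assumes "0 < sq_norm_vec d v"
  shows "(\<integral>\<^sup>+x. ennreal (exp ((inner_vec d v x)\<^sup>2 / (K\<^sup>2 * sq_norm_vec d v))) \<partial>\<mu>) \<le> 2"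
proof -
  define s where "s = 1 / sqrt (sq_norm_vec d v)"
  have s: "s\<^sup>2 = 1 / sq_norm_vec d v" using assms by (simp add: s_def power_divide)
  define u where "u = (\<lambda>j. s * v j)"
  have "sq_norm_vec d u = 1" using assms by (simp add: u_def sq_norm_vec_scale s)
  then have int: "integrable \<mu> (\<lambda>x. exp ((inner_vec d u x)\<^sup>2 / K\<^sup>2))"
    and le: "(\<integral>x. exp ((inner_vec d u x)\<^sup>2 / K\<^sup>2) \<partial>\<mu>) \<le> 2"
    using subgaussian by (auto simp: subgaussian_def)
  have "inner_vec d u x = s * inner_vec d v x" for x
    by (simp add: u_def inner_vec_def sum_distrib_left mult_ac)
  then have "(inner_vec d u x)\<^sup>2 / K\<^sup>2 = (inner_vec d v x)\<^sup>2 / (K\<^sup>2 * sq_norm_vec d v)" for x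
    by (simp add: power_mult_distrib s)
  then show ?thesis
    using nn_integral_eq_integral[OF int] le ennreal_leI[OF le] by simp
qed

text \<open>Normalised so that exp \<open>W\<close> linearises through a standard Gaussian; the
  outlier condition of squared norm at least 8 K^2 d reads \<open>4 * d \<le> W x\<close>.\<close>

definition W :: "(nat \<Rightarrow> real) \<Rightarrow> real" where
  "W x = sq_norm_vec d x / (2 * K\<^sup>2)"

lemma W_measurable [measurable]: "W \<in> borel_measurable \<mu>"
  unfolding W_def by measurable

lemma W_nonneg: "0 \<le> W x"
  by (simp add: W_def sq_norm_vec_nonneg)

text \<open>With r the norm of \<open>g\<close>, apply 2ab \<le> a^2 + b^2 to a =
  \<open>inner_vec d g x / (K * r)\<close> and b = r/2; exp (a^2) has mean at most 2.\<close>

lemma nn_integral_exp_inner_linear: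
  "(\<integral>\<^sup>+x. ennreal (exp (inner_vec d g x / K)) \<partial>\<mu>) \<le> ennreal (2 * exp (sq_norm_vec d g / 4))"
proof (cases "sq_norm_vec d g = 0")
  case True
  then have "inner_vec d g x = 0" for x
    using inner_vec_Cauchy_Schwarz[of d g x] by simp
  then show ?thesis using True by (simp add: emeasure_space_1)
next
  case False
  then have g: "0 < sq_norm_vec d g" using sq_norm_vec_nonneg[of d g] by simp
  have "(\<integral>\<^sup>+x. ennreal (exp (inner_vec d g x / K)) \<partial>\<mu>) \<le>
      (\<integral>\<^sup>+x. ennreal (exp (sq_norm_vec d g / 4)) * ennreal (exp ((inner_vec d g x)\<^sup>2 / (K\<^sup>2 * sq_norm_vec d g))) \<partial>\<mu>)"
  proof (rule nn_integral_mono)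
    fix x
    define r where "r = sqrt (sq_norm_vec d g)"
    have r: "r > 0" "r\<^sup>2 = sq_norm_vec d g" using g by (auto simp: r_def)
    have "inner_vec d g x / K = 2 * (inner_vec d g x / (K * r)) * (r / 2)"
      using r K_pos by simp
    also have "\<dots> \<le> (inner_vec d g x / (K * r))\<^sup>2 + (r / 2)\<^sup>2" by (rule sum_squares_bound)
    finally have "inner_vec d g x / K \<le> sq_norm_vec d g / 4 + (inner_vec d g x)\<^sup>2 / (K\<^sup>2 * sq_norm_vec d g)"
      by (simp add: power_divide power_mult_distrib r)
    then show "ennreal (exp (inner_vec d g x / K)) \<le>
        ennreal (exp (sq_norm_vec d g / 4)) * ennreal (exp ((inner_vec d g x)\<^sup>2 / (K\<^sup>2 * sq_norm_vec d g)))"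
      by (simp add: ennreal_mult'[symmetric] exp_add[symmetric])
  qed
  also have "\<dots> = ennreal (exp (sq_norm_vec d g / 4)) *
      (\<integral>\<^sup>+x. ennreal (exp ((inner_vec d g x)\<^sup>2 / (K\<^sup>2 * sq_norm_vec d g))) \<partial>\<mu>)"
    by (rule nn_integral_cmult) measurable
  also have "\<dots> \<le> ennreal (exp (sq_norm_vec d g / 4)) * 2"
    by (intro mult_left_mono nn_integral_exp_inner g) auto
  also have "\<dots> = ennreal (2 * exp (sq_norm_vec d g / 4))"
    by (simp add: ennreal_mult mult.commute)
  finally show ?thesis .
qed

text \<open>Gaussian linearisation: \<open>exp (\<bar>x\<bar>\<^sup>2/(2K\<^sup>2))\<close> is the average of \<open>exp (\<langle>g,x\<rangle>/K)\<close> over a standard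
  Gaussian \<open>g\<close>, which reduces the norm to one-dimensional marginals after swapping the integrals.\<close>
lemma nn_integral_exp_W: "(\<integral>\<^sup>+x. ennreal (exp (W x)) \<partial>\<mu>) \<le> 4 ^ d"
proof -
  interpret L: product_sigma_finite "\<lambda>_::nat. lborel :: real measure"
    by (simp add: product_sigma_finite_def lborel.sigma_finite_measure_axioms)
  let ?L = "PiM {..<d} (\<lambda>_. lborel :: real measure)"
  interpret Lf: sigma_finite_measure ?L by (rule L.sigma_finite) simp
  interpret pair_sigma_finite \<mu> ?L ..
  have sets_L [measurable_cong]: "sets ?L = sets (PiM {..<d} (\<lambda>_. borel :: real measure))"
    by (intro sets_PiM_cong) auto
  let ?\<phi> = std_normal_density
  \<comment> \<open>The Gaussian weight sits in the integrand, coordinate by coordinate, so that the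
    integral over \<open>g\<close> factors over \<open>lborel\<close>.\<close>
  let ?F = "\<lambda>x g. \<Prod>j<d. ennreal (exp (x j / K * g j) * ?\<phi> (g j))"
  have "(\<integral>\<^sup>+x. ennreal (exp (W x)) \<partial>\<mu>) = (\<integral>\<^sup>+x. \<integral>\<^sup>+g. ?F x g \<partial>?L \<partial>\<mu>)"
  proof (rule nn_integral_cong)
    fix x
    have "(\<integral>\<^sup>+g. ?F x g \<partial>?L) = (\<Prod>j<d. \<integral>\<^sup>+g. ennreal (exp (x j / K * g) * ?\<phi> g) \<partial>lborel)"
      by (rule L.product_nn_integral_prod) auto
    also have "\<dots> = ennreal (\<Prod>j<d. exp ((x j / K)\<^sup>2 / 2))"
      by (simp only: nn_integral_std_normal_exp prod_ennreal exp_ge_zero)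
    also have "(\<Prod>j<d. exp ((x j / K)\<^sup>2 / 2)) = exp (W x)"
      by (simp add: exp_sum[symmetric] W_def sq_norm_vec_def power_divide sum_divide_distrib mult.commute)
    finally show "ennreal (exp (W x)) = (\<integral>\<^sup>+g. ?F x g \<partial>?L)" ..
  qed
  also have "\<dots> = (\<integral>\<^sup>+g. \<integral>\<^sup>+x. ?F x g \<partial>\<mu> \<partial>?L)"
    by (rule Fubini'[symmetric]) measurable
  \<comment> \<open>For fixed \<open>g\<close> only a one-dimensional marginal remains; its bound
    again factors over the coordinates of \<open>g\<close>.\<close>
  also have "\<dots> \<le> (\<integral>\<^sup>+g. 2 * (\<Prod>j<d. ennreal (exp ((g j)\<^sup>2 / 4) * ?\<phi> (g j))) \<partial>?L)"
  proof (rule nn_integral_mono)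
    fix g :: "nat \<Rightarrow> real"
    have F: "?F x g = ennreal (\<Prod>j<d. ?\<phi> (g j)) * ennreal (exp (inner_vec d g x / K))" for x
    proof -
      have "(\<Prod>j<d. exp (x j / K * g j)) = exp (inner_vec d g x / K)"
        by (simp add: exp_sum[symmetric] inner_vec_def sum_divide_distrib mult.commute)
      then show ?thesis
        by (simp add: prod_ennreal prod.distrib ennreal_mult'[symmetric] prod_nonneg mult.commute)
    qed
    have "(\<integral>\<^sup>+x. ?F x g \<partial>\<mu>) = ennreal (\<Prod>j<d. ?\<phi> (g j)) * (\<integral>\<^sup>+x. ennreal (exp (inner_vec d g x / K)) \<partial>\<mu>)"
      unfolding F by (rule nn_integral_cmult) measurable
    also have "\<dots> \<le> ennreal (\<Prod>j<d. ?\<phi> (g j)) * ennreal (2 * exp (sq_norm_vec d g / 4))"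
      by (intro mult_left_mono nn_integral_exp_inner_linear) auto
    also have "\<dots> = 2 * (ennreal (exp (sq_norm_vec d g / 4)) * ennreal (\<Prod>j<d. ?\<phi> (g j)))"
      by (simp add: ennreal_mult mult_ac)
    also have "exp (sq_norm_vec d g / 4) = (\<Prod>j<d. exp ((g j)\<^sup>2 / 4))"
      by (simp add: exp_sum[symmetric] sq_norm_vec_def sum_divide_distrib)
    finally show "(\<integral>\<^sup>+x. ?F x g \<partial>\<mu>) \<le> 2 * (\<Prod>j<d. ennreal (exp ((g j)\<^sup>2 / 4) * ?\<phi> (g j)))"
      by (simp add: prod_ennreal prod.distrib ennreal_mult'[symmetric] prod_nonneg)
  qed
  also have "\<dots> = 2 * (\<integral>\<^sup>+g. (\<Prod>j<d. ennreal (exp ((g j)\<^sup>2 / 4) * ?\<phi> (g j))) \<partial>?L)"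
    by (rule nn_integral_cmult) measurable
  also have "\<dots> = 2 * ennreal (sqrt 2) ^ d"
    by (simp add: L.product_nn_integral_prod[of "{..<d}" "\<lambda>_ g. ennreal (exp (g\<^sup>2 / 4) * ?\<phi> g)"]
        nn_integral_std_normal_exp_square)
  \<comment> \<open>The prefactor 2 is absorbed into \<open>2 ^ d\<close> by
    \<open>d_ge_1\<close>.\<close>
  also have "\<dots> \<le> 2 ^ d * 2 ^ d"
  proof (intro mult_mono power_mono)
    show "(2::ennreal) \<le> 2 ^ d" using power_increasing[of 1 d "2::ennreal"] d_ge_1 by simp
    show "ennreal (sqrt 2) \<le> 2"
      using ennreal_leI[of "sqrt 2" 2] sqrt2_less_2 by simp
  qed auto
  also have "\<dots> = 4 ^ d" by (simp add: power_mult_distrib[symmetric])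
  finally show ?thesis .
qed

section \<open>Dimension-free tails of the outliers\<close>

text \<open>Since 4 \<le> exp 2, shifting the exponent by \<open>2 * d\<close> cancels the factor
  \<open>4 ^ d\<close>.\<close>

lemma nn_integral_exp_W_scaled:
  "(\<integral>\<^sup>+x. ennreal c * ennreal (exp (W x - 2 * d)) \<partial>\<mu>) \<le> ennreal c"
proof -
  have "(\<integral>\<^sup>+x. ennreal c * ennreal (exp (W x - 2 * d)) \<partial>\<mu>) =
      (\<integral>\<^sup>+x. ennreal c * ennreal (exp (- 2 * d)) * ennreal (exp (W x)) \<partial>\<mu>)"
    by (simp add: mult.assoc ennreal_mult'[symmetric] exp_add[symmetric])
  also have "\<dots> = ennreal c * ennreal (exp (- 2 * d)) * (\<integral>\<^sup>+x. ennreal (exp (W x)) \<partial>\<mu>)"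
    by (rule nn_integral_cmult) measurable
  also have "\<dots> \<le> ennreal c * ennreal (exp (- 2 * d)) * 4 ^ d"
    by (intro mult_left_mono nn_integral_exp_W) auto
  also have "\<dots> = ennreal c * ennreal (exp (- 2 * d) * 4 ^ d)"
    by (simp add: ennreal_mult ennreal_power[symmetric] mult.assoc)
  also have "\<dots> \<le> ennreal c * ennreal 1"
  proof (intro mult_left_mono ennreal_leI)
    have "(4::real) \<le> exp 2"
      using exp_ge_add_one_self[of 1] power_mono[of 2 "exp 1::real" 2]
      by (simp add: exp_of_nat_mult[symmetric] exp_double[symmetric])
    then have "4 ^ d \<le> exp (2::real) ^ d" by (intro power_mono) auto
    then show "exp (- 2 * d) * 4 ^ d \<le> (1::real)"
      by (simp add: exp_minus exp_of_nat_mult[symmetric] field_simps)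
  qed simp
  finally show ?thesis by simp
qed

text \<open>On outliers \<open>2 * d\<close> is at most W/2, so W - 2d \<ge> W/2 \<ge> m/2 and
  Markov applies without dependence on \<open>d\<close>.\<close>

lemma emeasure_outlier_le:
  "emeasure \<mu> {x \<in> space \<mu>. 4 * d \<le> W x \<and> m \<le> W x} \<le> ennreal (exp (- m / 2))"
proof -
  have "emeasure \<mu> {x \<in> space \<mu>. 4 * d \<le> W x \<and> m \<le> W x} \<le>
      (\<integral>\<^sup>+x. ennreal (exp (- m / 2)) * ennreal (exp (W x - 2 * d)) \<partial>\<mu>)"
    by (rule emeasure_Collect_le_nn_integral)
       (auto simp: ennreal_mult'[symmetric] exp_add[symmetric])
  also have "\<dots> \<le> ennreal (exp (- m / 2))" by (rule nn_integral_exp_W_scaled)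
  finally show ?thesis .
qed

text \<open>The same W - 2d \<ge> W/2 is combined with exp t \<ge> t^2/2 at t = W/2, which produces
  the 8. The bound is uniform in \<open>d\<close> and \<open>m\<close>.\<close>

lemma nn_integral_outlier_le:
  "(\<integral>\<^sup>+x. ennreal (if 4 * d \<le> W x \<and> W x < m then (W x)\<^sup>2 else 0) \<partial>\<mu>) \<le> ennreal 8"
proof -
  have "(\<integral>\<^sup>+x. ennreal (if 4 * d \<le> W x \<and> W x < m then (W x)\<^sup>2 else 0) \<partial>\<mu>) \<le>
      (\<integral>\<^sup>+x. ennreal 8 * ennreal (exp (W x - 2 * d)) \<partial>\<mu>)"
  proof (rule nn_integral_mono)
    fix x
    have "(if 4 * d \<le> W x \<and> W x < m then (W x)\<^sup>2 else 0) \<le> 8 * exp (W x - 2 * d)"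
    proof (cases "4 * d \<le> W x")
      case True
      have "(W x)\<^sup>2 \<le> 8 * exp (W x / 2)"
        using exp_lower_Taylor_quadratic[of "W x / 2"] W_nonneg[of x]
        by (simp add: power_divide)
      also have "\<dots> \<le> 8 * exp (W x - 2 * d)" using True by simp
      finally show ?thesis by simp
    qed simp
    then show "ennreal (if 4 * d \<le> W x \<and> W x < m then (W x)\<^sup>2 else 0) \<le> ennreal 8 * ennreal (exp (W x - 2 * d))"
      by (subst ennreal_mult'[symmetric]) (auto intro: ennreal_leI)
  qed
  also have "\<dots> \<le> ennreal 8" by (rule nn_integral_exp_W_scaled)
  finally show ?thesis .
qed

section \<open>Off-diagonal Gram row sums\<close>

lemma row_sum_gt_sets:
  fixes n i :: nat
  assumes i: "i < n"
  shows "{X \<in> space (PiM {..<n} (\<lambda>_. \<mu>)). c * sq_norm_vec d (X i) <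
      (\<Sum>j\<in>{..<n} - {i}. (inner_vec d (X i) (X j))\<^sup>2)} \<in> sets (PiM {..<n} (\<lambda>_. \<mu>))"
proof -
  have comp: "(\<lambda>X. X j) \<in> measurable (PiM {..<n} (\<lambda>_. \<mu>)) (PiM {..<d} (\<lambda>_. borel))"
    if "j < n" for j
    using that measurable_component_singleton[of j "{..<n}" "\<lambda>_. \<mu>"]
    by (simp add: measurable_cong_sets[OF refl sets_eq])
  show ?thesis
    by (intro borel_measurable_less borel_measurable_times borel_measurable_const borel_measurable_sum
        borel_measurable_power sq_norm_vec_measurable inner_vec_measurable comp i) auto
qed

text \<open>With sample \<open>i\<close> frozen at \<open>y\<close>, the other samples contribute
  independent factors of mean at most 2. Markov gives exp (-2n) 2^(n-1) \<le> exp (-n), uniformly in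
  \<open>y\<close>.\<close>

lemma emeasure_row_sum_gt_le:
  fixes n i :: nat
  assumes i: "i < n"
  shows "emeasure (PiM {..<n} (\<lambda>_. \<mu>)) {X \<in> space (PiM {..<n} (\<lambda>_. \<mu>)).
      2 * K\<^sup>2 * n * sq_norm_vec d (X i) < (\<Sum>j\<in>{..<n} - {i}. (inner_vec d (X i) (X j))\<^sup>2)}
    \<le> ennreal (exp (- real n))" (is "emeasure ?P ?A \<le> _")
proof -
  interpret P: product_prob_space "\<lambda>_::nat. \<mu>" UNIV ..
  define I where "I = {..<n} - {i}"
  have I: "finite I" "i \<notin> I" "{..<n} = insert i I" using i by (auto simp: I_def)
  have A: "?A \<in> sets ?P" using i by (rule row_sum_gt_sets)
  have row: "(\<integral>\<^sup>+x. indicator ?A (x(i := y)) \<partial>PiM I (\<lambda>_. \<mu>)) \<le> ennreal (exp (- real n))" for y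
  proof (cases "sq_norm_vec d y = 0")
    case True
    then have "inner_vec d y x = 0" for x
      using inner_vec_Cauchy_Schwarz[of d y x] by simp
    then have "x(i := y) \<notin> ?A" for x
      using True by simp
    then show ?thesis by simp
  next
    case False
    then have y: "0 < sq_norm_vec d y" using sq_norm_vec_nonneg[of d y] by simp
    let ?h = "\<lambda>x. (inner_vec d y x)\<^sup>2 / (K\<^sup>2 * sq_norm_vec d y)"
    have "(\<integral>\<^sup>+x. indicator ?A (x(i := y)) \<partial>PiM I (\<lambda>_. \<mu>)) \<le>
        (\<integral>\<^sup>+x. ennreal (exp (- 2 * n)) * (\<Prod>j\<in>I. ennreal (exp (?h (x j)))) \<partial>PiM I (\<lambda>_. \<mu>))"
    proof (rule nn_integral_mono)
      fix x
      show "indicator ?A (x(i := y)) \<le> ennreal (exp (- 2 * n)) * (\<Prod>j\<in>I. ennreal (exp (?h (x j))))"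
      proof (cases "x(i := y) \<in> ?A")
        case True
        have "(\<Sum>j\<in>I. (inner_vec d y ((x(i := y)) j))\<^sup>2) = (\<Sum>j\<in>I. (inner_vec d y (x j))\<^sup>2)"
          using I(2) by (intro sum.cong) auto
        with True have "2 * K\<^sup>2 * n * sq_norm_vec d y < (\<Sum>j\<in>I. (inner_vec d y (x j))\<^sup>2)"
          by (simp add: I_def)
        then have "0 \<le> - 2 * n + (\<Sum>j\<in>I. ?h (x j))"
          using y K_pos by (simp add: sum_divide_distrib[symmetric] field_simps)
        then have "1 \<le> exp (- 2 * n) * (\<Prod>j\<in>I. exp (?h (x j)))"
          unfolding exp_sum[OF I(1), symmetric] exp_add[symmetric] by simp
        then show ?thesis
          using True by (simp add: prod_ennreal ennreal_mult'[symmetric] prod_nonneg)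
      qed simp
    qed
    also have "\<dots> = ennreal (exp (- 2 * n)) * (\<integral>\<^sup>+x. ennreal (exp (?h x)) \<partial>\<mu>) ^ card I"
      using I(1) by (simp add: nn_integral_cmult P.product_nn_integral_prod[of I "\<lambda>_ x. ennreal (exp (?h x))"])
    also have "\<dots> \<le> ennreal (exp (- 2 * n)) * 2 ^ card I"
      by (intro mult_left_mono power_mono nn_integral_exp_inner y) auto
    also have "\<dots> = ennreal (exp (- 2 * n) * 2 ^ card I)"
      by (simp add: ennreal_mult ennreal_power[symmetric])
    also have "\<dots> \<le> ennreal (exp (- real n))"
    proof (rule ennreal_leI)
      have "card I \<le> n" using i by (simp add: I_def)
      then have "(2::real) ^ card I \<le> 2 ^ n" by (intro power_increasing) auto
      also have "\<dots> \<le> exp 1 ^ n"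
        using exp_ge_add_one_self[of 1] by (intro power_mono) auto
      also have "\<dots> = exp (real n)" by (simp add: exp_of_nat_mult[symmetric])
      finally have "exp (- 2 * n) * 2 ^ card I \<le> exp (- 2 * n) * exp (real n)"
        by (intro mult_left_mono) auto
      then show "exp (- 2 * n) * 2 ^ card I \<le> exp (- real n)"
        by (simp add: exp_add[symmetric])
    qed
    finally show ?thesis .
  qed
  have "emeasure ?P ?A = (\<integral>\<^sup>+X. indicator ?A X \<partial>?P)"
    using A by simp
  \<comment> \<open>Fubini with coordinate \<open>i\<close> outermost, which realises the
    conditioning.\<close>
  also have "\<dots> = (\<integral>\<^sup>+y. \<integral>\<^sup>+x. indicator ?A (x(i := y)) \<partial>PiM I (\<lambda>_. \<mu>) \<partial>\<mu>)"
    using A I(1,2) unfolding I(3) by (intro P.product_nn_integral_insert_rev) auto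
  also have "\<dots> \<le> (\<integral>\<^sup>+y. ennreal (exp (- real n)) \<partial>\<mu>)"
    by (intro nn_integral_mono row)
  finally show ?thesis by (simp add: emeasure_space_1)
qed

text \<open>Needed because \<open>measure\<close> is 0 on non-measurable sets; the supremum runs over an uncountable set.\<close>
lemma opnorm_fourth_moment_measurable:
  assumes "0 \<le> c"
  shows "{X \<in> space (PiM {..<n} (\<lambda>_. \<mu>)). opnorm (d*d) (fourth_moment_matrix d n X) \<le> c}
    \<in> sets (PiM {..<n} (\<lambda>_. \<mu>))"
proof -
  let ?P = "PiM {..<n} (\<lambda>_. \<mu>)"
  have comp [measurable]: "(\<lambda>X. X i a) \<in> borel_measurable ?P" if "i < n" "a < d" for i a
  proof -
    have "(\<lambda>x. x a) \<in> borel_measurable \<mu>"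
      using that by (simp add: measurable_cong_sets[OF sets_eq refl])
    from measurable_compose[OF measurable_component_singleton[of i "{..<n}" "\<lambda>_. \<mu>"] this] that
    show ?thesis by simp
  qed
  have div: "p div d < d" if "p < d * d" for p using that by (simp add: less_mult_imp_div_less)
  have mod: "p mod d < d" for p using d_ge_1 by simp
  have "(\<lambda>X. fourth_moment_matrix d n X p q) \<in> borel_measurable ?P" if "p < d*d" "q < d*d" for p q
    unfolding fourth_moment_matrix_def outer_def kron_def
    by (intro borel_measurable_sum borel_measurable_times comp div mod that) auto
  then have "(\<lambda>X. \<Sum>p<d*d. (\<Sum>q<d*d. fourth_moment_matrix d n X p q * v q)\<^sup>2) \<in> borel_measurable ?P" for v
    by (intro borel_measurable_sum borel_measurable_power borel_measurable_times) auto
  \<comment> \<open>The event is now a countable intersection over \<open>rat list\<close>.\<close>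
  then show ?thesis
    unfolding opnorm_le_iff_rat[OF assms] by measurable
qed

section \<open>The union bound\<close>

text \<open>Three kinds of bad event: a large row sum, an outlier beyond the truncation level
  \<open>m\<close>, and a large truncated outlier sum. As \<open>m\<close> squared is
  \<open>sqrt n\<close>, both outlier estimates are stretched-exponentially small in
  \<open>n\<close>.\<close>

lemma measure_opnorm_fourth_moment_ge:
  assumes "d \<le> n" "1 \<le> n"
  defines "m \<equiv> real n powr (1/4)"
  shows "1 - (n * exp (- real n) + n * exp (- m / 2) + exp (- sqrt n)) \<le>
    measure (PiM {..<n} (\<lambda>_. \<mu>)) {X \<in> space (PiM {..<n} (\<lambda>_. \<mu>)).
      opnorm (d*d) (fourth_moment_matrix d n X) \<le> 148 * K^4 * n * d}" (is "_ \<le> measure ?P ?G")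
proof -
  interpret P: product_prob_space "\<lambda>_::nat. \<mu>" UNIV ..
  interpret PP: prob_space ?P by (intro prob_space_PiM prob_space_axioms)
  define f where "f x = (if 4 * d \<le> W x \<and> W x < m then (W x)\<^sup>2 else 0)" for x
  define A where "A i = {X \<in> space ?P. 2 * K\<^sup>2 * n * sq_norm_vec d (X i) <
      (\<Sum>j\<in>{..<n} - {i}. (inner_vec d (X i) (X j))\<^sup>2)}" for i
  define B where "B i = {X \<in> space ?P. X i \<in> {x \<in> space \<mu>. 4 * d \<le> W x \<and> m \<le> W x}}" for i
  \<comment> \<open>The Chernoff threshold for mean bound 8. Squared norms are 2 K^2 W, so 4 * 17 =
    68 is the outlier constant.\<close>
  define E where "E = {X \<in> space ?P. (2 * 8 + 1) * real n < (\<Sum>i<n. f (X i))}"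
  have m: "m\<^sup>2 = sqrt n"
    using assms by (simp add: m_def powr_half_sqrt[symmetric] powr_powr flip: powr_numeral)
  have f_meas [measurable]: "f \<in> borel_measurable \<mu>" unfolding f_def by measurable
  have A_sets: "A i \<in> sets ?P" if "i < n" for i
    unfolding A_def using that by (rule row_sum_gt_sets)
  have B_sets: "B i \<in> sets ?P" if "i < n" for i
  proof -
    have "{x \<in> space \<mu>. 4 * d \<le> W x \<and> m \<le> W x} \<in> sets \<mu>" by measurable
    from measurable_sets[OF measurable_component_singleton[of i "{..<n}" "\<lambda>_. \<mu>"] this] that
    show ?thesis by (simp add: B_def vimage_def Int_def conj_commute)
  qed
  have E_sets: "E \<in> sets ?P" unfolding E_def by measurable
  have A_le: "measure ?P (A i) \<le> exp (- real n)" if "i < n" for i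
    using emeasure_row_sum_gt_le[OF that] by (simp add: A_def PP.emeasure_eq_measure)
  have B_le: "measure ?P (B i) \<le> exp (- m / 2)" if "i < n" for i
  proof -
    have "distr ?P \<mu> (\<lambda>X. X i) = \<mu>"
      using that by (intro distr_PiM_component prob_space_axioms) auto
    moreover have "B i = (\<lambda>X. X i) -` {x \<in> space \<mu>. 4 * d \<le> W x \<and> m \<le> W x} \<inter> space ?P"
      by (auto simp: B_def)
    ultimately have "emeasure ?P (B i) = emeasure \<mu> {x \<in> space \<mu>. 4 * d \<le> W x \<and> m \<le> W x}"
      using that emeasure_distr[of "\<lambda>X. X i" ?P \<mu> "{x \<in> space \<mu>. 4 * d \<le> W x \<and> m \<le> W x}"] by simp
    with emeasure_outlier_le[of m] have "emeasure ?P (B i) \<le> ennreal (exp (- m / 2))" by simp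
    then show ?thesis by (simp add: PP.emeasure_eq_measure)
  qed
  have E_le: "measure ?P E \<le> exp (- sqrt n)"
  proof -
    have "emeasure ?P E \<le> ennreal (exp (- (n / sqrt n)))"
      unfolding E_def
    proof (rule emeasure_PiM_sum_gt_le)
      fix x show "f x \<le> sqrt n"
        unfolding f_def m[symmetric] by (auto intro: power_mono W_nonneg)
      show "(\<integral>\<^sup>+x. ennreal (f x) \<partial>\<mu>) \<le> ennreal 8"
        unfolding f_def by (rule nn_integral_outlier_le)
    qed (use assms in \<open>auto simp: f_def\<close>)
    then show ?thesis by (simp add: PP.emeasure_eq_measure real_div_sqrt)
  qed
  define Bad where "Bad = (\<Union>i<n. A i) \<union> (\<Union>i<n. B i) \<union> E"
  have UN: "(\<Union>i<n. A i) \<in> sets ?P" "(\<Union>i<n. B i) \<in> sets ?P"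
    using A_sets B_sets by auto
  then have Bad_sets: "Bad \<in> sets ?P"
    unfolding Bad_def using E_sets by auto
  have "measure ?P Bad \<le> measure ?P (\<Union>i<n. A i) + measure ?P (\<Union>i<n. B i) + measure ?P E"
    unfolding Bad_def using UN E_sets
    by (meson measure_Un_le add_right_mono order.trans sets.Un)
  also have "measure ?P (\<Union>i<n. A i) \<le> (\<Sum>i<n. measure ?P (A i))"
    using A_sets by (intro PP.finite_measure_subadditive_finite) auto
  also have "\<dots> \<le> n * exp (- real n)"
    using sum_bounded_above[of "{..<n}" "\<lambda>i. measure ?P (A i)" "exp (- real n)"] A_le by simp
  also have "measure ?P (\<Union>i<n. B i) \<le> (\<Sum>i<n. measure ?P (B i))"
    using B_sets by (intro PP.finite_measure_subadditive_finite) auto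
  also have "\<dots> \<le> n * exp (- m / 2)"
    using sum_bounded_above[of "{..<n}" "\<lambda>i. measure ?P (B i)" "exp (- m / 2)"] B_le by simp
  finally have Bad_le: "measure ?P Bad \<le> n * exp (- real n) + n * exp (- m / 2) + exp (- sqrt n)"
    using E_le by linarith
  have "space ?P - Bad \<subseteq> ?G"
  proof
    fix X assume X: "X \<in> space ?P - Bad"
    have W: "sq_norm_vec d x = 2 * K\<^sup>2 * W x" for x using K_pos by (simp add: W_def)
    have "opnorm (d*d) (fourth_moment_matrix d n X) \<le> 148 * K^4 * n * d"
    proof (rule opnorm_fourth_moment_matrix_le)
      fix i assume "i < n"
      then show "(\<Sum>j\<in>{..<n} - {i}. (inner_vec d (X i) (X j))\<^sup>2) \<le> 2 * K\<^sup>2 * n * sq_norm_vec d (X i)"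
        using X by (auto simp: Bad_def A_def not_less)
    next
      have iff: "8 * K\<^sup>2 * d \<le> sq_norm_vec d x \<longleftrightarrow> 4 * d \<le> W x" for x
        using K_pos by (simp add: W_def field_simps)
      \<comment> \<open>Off the events \<open>B i\<close> every outlier lies below \<open>m\<close>,
        so the truncation is inactive.\<close>
      have f: "(W (X i))\<^sup>2 = f (X i)" if "i < n" "4 * d \<le> W (X i)" for i
      proof -
        have "X i \<in> space \<mu>" using X that by (auto simp: space_PiM PiE_iff)
        then show ?thesis using X that by (auto simp: Bad_def B_def f_def)
      qed
      have "(\<Sum>i | i < n \<and> 8 * K\<^sup>2 * d \<le> sq_norm_vec d (X i). (sq_norm_vec d (X i))\<^sup>2) =
          (\<Sum>i | i < n \<and> 4 * d \<le> W (X i). 4 * K^4 * f (X i))"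
        unfolding iff
        by (intro sum.cong) (auto simp: f[symmetric] W power_mult_distrib simp flip: power_mult)
      also have "\<dots> \<le> (\<Sum>i<n. 4 * K^4 * f (X i))"
        by (intro sum_mono2) (auto simp: f_def)
      also have "\<dots> = 4 * K^4 * (\<Sum>i<n. f (X i))" by (simp add: sum_distrib_left)
      also have "\<dots> \<le> 4 * K^4 * ((2 * 8 + 1) * real n)"
        using X by (intro mult_left_mono) (auto simp: Bad_def E_def)
      finally show "(\<Sum>i | i < n \<and> 8 * K\<^sup>2 * d \<le> sq_norm_vec d (X i). (sq_norm_vec d (X i))\<^sup>2) \<le> 68 * K^4 * n"
        by simp
    qed (use assms d_ge_1 in auto)
    then show "X \<in> ?G" using X by simp
  qed
  moreover have "?G \<in> sets ?P" by (rule opnorm_fourth_moment_measurable) simp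
  ultimately have "measure ?P (space ?P - Bad) \<le> measure ?P ?G"
    by (rule PP.finite_measure_mono)
  then show ?thesis
    using PP.prob_compl[OF Bad_sets] Bad_le by simp
qed

end

section \<open>Choice of constants and of the threshold \<open>N\<close>\<close>

text \<open>The probability 1 - n^(-omega(1)) is expressed by a threshold \<open>N\<close> for every
  exponent \<open>D\<close>, uniform in \<open>d\<close> and the distribution. This works because
  the failure bound depends on \<open>n\<close> alone.\<close>

theorem mainTheorem15:
  "\<forall>K>0. \<exists>C0>0. \<exists>C>0. \<forall>D>0. \<exists>N::nat. \<forall>(d::nat) (n::nat) (\<mu>::(nat \<Rightarrow> real) measure).
     d \<ge> 1 \<and> n \<ge> N \<and> real n \<ge> real d * (ln (real d)) powr C0 \<and>
     distr_Rd d \<mu> \<and> subgaussian d K \<mu> \<and> mean_zero d \<mu> \<and> opnorm d (covariance \<mu>) \<le> 1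
     \<longrightarrow> 1 - real n powr (-D) \<le>
         measure (PiM {..<n} (\<lambda>_. \<mu>))
           {X \<in> space (PiM {..<n} (\<lambda>_. \<mu>)).
              opnorm (d*d) (fourth_moment_matrix d n X) \<le> C * real n * real d}"
proof (intro allI impI)
  fix K :: real assume K: "0 < K"
  \<comment> \<open>Stretched exponentials beat every power of \<open>n\<close>;
    \<open>n \<ge> 2\<close> is included to cover \<open>d \<le> 2\<close> below.\<close>
  have ex_N: "\<exists>N::nat. \<forall>n\<ge>N. n \<ge> 2 \<and>
      n * exp (- real n) + n * exp (- (real n powr (1/4)) / 2) + exp (- sqrt n) \<le> real n powr (-D)" for D
  proof -
    have "eventually (\<lambda>n::nat. n \<ge> 2 \<and>
      n * exp (- real n) + n * exp (- (real n powr (1/4)) / 2) + exp (- sqrt n) \<le> real n powr (-D)) at_top"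
      by (intro eventually_conj eventually_ge_at_top) real_asymp
    then show ?thesis by (simp add: eventually_at_top_linorder)
  qed
  show "\<exists>C0>0. \<exists>C>0. \<forall>D>0. \<exists>N::nat. \<forall>(d::nat) (n::nat) (\<mu>::(nat \<Rightarrow> real) measure).
     d \<ge> 1 \<and> n \<ge> N \<and> real n \<ge> real d * (ln (real d)) powr C0 \<and>
     distr_Rd d \<mu> \<and> subgaussian d K \<mu> \<and> mean_zero d \<mu> \<and> opnorm d (covariance \<mu>) \<le> 1
     \<longrightarrow> 1 - real n powr (-D) \<le>
         measure (PiM {..<n} (\<lambda>_. \<mu>))
           {X \<in> space (PiM {..<n} (\<lambda>_. \<mu>)).
              opnorm (d*d) (fourth_moment_matrix d n X) \<le> C * real n * real d}"
  proof (rule exI[of _ 1], intro conjI, simp, rule exI[of _ "148 * K^4"], intro conjI allI impI)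
    fix D :: real assume "0 < D"
    obtain N where N: "\<And>n. n \<ge> N \<Longrightarrow> n \<ge> 2 \<and>
        n * exp (- real n) + n * exp (- (real n powr (1/4)) / 2) + exp (- sqrt n) \<le> real n powr (-D)"
      using ex_N by blast
    show "\<exists>N::nat. \<forall>(d::nat) (n::nat) (\<mu>::(nat \<Rightarrow> real) measure).
     d \<ge> 1 \<and> n \<ge> N \<and> real n \<ge> real d * (ln (real d)) powr 1 \<and>
     distr_Rd d \<mu> \<and> subgaussian d K \<mu> \<and> mean_zero d \<mu> \<and> opnorm d (covariance \<mu>) \<le> 1
     \<longrightarrow> 1 - real n powr (-D) \<le>
         measure (PiM {..<n} (\<lambda>_. \<mu>))
           {X \<in> space (PiM {..<n} (\<lambda>_. \<mu>)).
              opnorm (d*d) (fourth_moment_matrix d n X) \<le> 148 * K^4 * real n * real d}"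
    proof (intro exI[of _ N] allI impI, elim conjE)
      fix d n :: nat and \<mu> :: "(nat \<Rightarrow> real) measure"
      assume *: "d \<ge> 1" "n \<ge> N" "real n \<ge> real d * (ln (real d)) powr 1"
        "distr_Rd d \<mu>" "subgaussian d K \<mu>"
      have n: "n \<ge> 2" using N *(2) by blast
      \<comment> \<open>For \<open>d\<close> at least 3 the logarithm is at least 1, so the growth
        condition with exponent 1 already gives the claim.\<close>
      have "d \<le> n"
      proof (cases "d \<le> 2")
        case False
        have "1 \<le> ln (real d)"
          using False exp_le by (subst ln_ge_iff) (auto intro: order.trans)
        then have "real d * 1 \<le> real d * ln (real d) powr 1" by (intro mult_left_mono) auto
        then show ?thesis using *(3) by linarith
      qed (use n in simp)
      interpret subgaussian_distr \<mu> d K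
        using * K by (auto simp: distr_Rd_def subgaussian_distr_def subgaussian_distr_axioms_def)
      show "1 - real n powr (-D) \<le>
         measure (PiM {..<n} (\<lambda>_. \<mu>))
           {X \<in> space (PiM {..<n} (\<lambda>_. \<mu>)).
              opnorm (d*d) (fourth_moment_matrix d n X) \<le> 148 * K^4 * real n * real d}"
        using measure_opnorm_fourth_moment_ge[OF \<open>d \<le> n\<close>] N[OF *(2)] n by linarith
    qed
  qed (use K in auto)
qed

end
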